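(* Let $n\ge 2$ and $q>0$. There is no $u\in C^{6}(\mathbb{R}^{n})$ with $u>0$ solving $\Delta^{3}u=u^{-q}$ in $\mathbb{R}^{n}$ and satisfying $u(x)=o(|x|^{6/(q+1)})$ as $|x|\to+\infty$. Moreover, there is no radially symmetric such solution $u=u(r)$ satisfying $\limsup_{r\to+\infty}u(r)/r^{6/(q+1)}<+\infty$ and $\liminf_{r\to+\infty}u(r)/r^{6/(q+1)}=0$. *)

theory Defs
  imports "HOL-Analysis.Analysis" "HOL-Library.Landau_Symbols"
begin

definition partial :: "'n::finite \<Rightarrow> (real^'n \<Rightarrow> real) \<Rightarrow> real^'n \<Rightarrow> real" where
  "partial i f x = deriv (\<lambda>t. f (x + t *\<^sub>R axis i 1)) 0"

fun Ck :: "nat \<Rightarrow> (real^'n::finite \<Rightarrow> real) \<Rightarrow> bool" where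
  "Ck 0 f = continuous_on UNIV f"
| "Ck (Suc k) f = (continuous_on UNIV f \<and>
     (\<forall>i. (\<forall>x. (\<lambda>t. f (x + t *\<^sub>R axis i 1)) differentiable (at 0)) \<and> Ck k (partial i f)))"

definition laplacian :: "(real^'n::finite \<Rightarrow> real) \<Rightarrow> real^'n \<Rightarrow> real" where
  "laplacian f x = (\<Sum>i\<in>UNIV. partial i (partial i f) x)"

end

theory Submission
  imports Defs
begin

text \<open>
  Let u be positive with u^(-q) \<le> \<Delta>^m u and put \<alpha> = 2 m / (q + 1), so that \<alpha> q = 2 m - \<alpha>. If u \<le> M on
  a ball of radius R, then \<Delta>^m u \<ge> M^(-q) there. Testing with a bump function rescaled to the ball and
  moving all derivatives onto it gives M^(-q) R^(2 m) \<le> C M, that is, M is at least a constant times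
  R^\<alpha>, whatever the centre of the ball. Balls of radius R / 4 inside the annulus R / 2 \<le> |x| \<le> R
  exclude u = o(|x|^\<alpha>).

  If u(x) = v(|x|), then \<Delta>^m u > 0 makes v eventually monotone, since integrating the radial
  Laplacian twice preserves the property of having eventually one sign. An eventually nonincreasing v
  is bounded, hence o(r^\<alpha>), which is already excluded. An eventually nondecreasing v inherits at r the
  lower bound on the annulus r / 2 \<le> |x| \<le> r, so v(r) / r^\<alpha> stays away from 0.
\<close>

section \<open>Functions with continuous partial derivatives\<close>

lemma partial_eqI:
  assumes "((\<lambda>t. f (x + t *\<^sub>R axis i 1)) has_real_derivative D) (at 0)"
  shows "partial i f x = D"
  using assms unfolding partial_def by (rule DERIV_imp_deriv)

lemma DERIV_line:
  fixes f :: "'a::real_vector \<Rightarrow> real"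
  assumes "\<And>x. ((\<lambda>t. f (x + t *\<^sub>R e)) has_real_derivative f' x) (at 0)"
  shows "((\<lambda>t. f (x + t *\<^sub>R e)) has_real_derivative f' (x + s *\<^sub>R e)) (at s)"
proof -
  have "((\<lambda>t. f (x + (t + s) *\<^sub>R e)) has_real_derivative f' (x + s *\<^sub>R e)) (at 0)"
    using assms[of "x + s *\<^sub>R e"] by (simp add: algebra_simps)
  then show ?thesis
    using DERIV_shift[of "\<lambda>t. f (x + t *\<^sub>R e)" _ 0 s] by simp
qed

lemma Ck_imp_continuous: "Ck k f \<Longrightarrow> continuous_on UNIV f"
  by (cases k) auto

lemma Ck_DERIV:
  assumes "Ck k f" "0 < k"
  shows "((\<lambda>t. f (x + t *\<^sub>R axis i 1)) has_real_derivative partial i f x) (at 0)"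
  using assms by (cases k) (auto simp: partial_def DERIV_deriv_iff_real_differentiable)

lemma Ck_partial: "Ck (Suc k) f \<Longrightarrow> Ck k (partial i f)"
  by simp

lemma Ck_2_partial: "Ck 2 f \<Longrightarrow> Ck 1 (partial i f)"
  by (rule Ck_partial) (simp only: Suc_1)

lemma Ck_1_imp_continuous_partial: "Ck 1 f \<Longrightarrow> continuous_on UNIV (partial i f)"
  by simp

lemma Ck_SucI:
  assumes "continuous_on UNIV f"
    and deriv: "\<And>i x. ((\<lambda>t. f (x + t *\<^sub>R axis i 1)) has_real_derivative f' i x) (at 0)"
    and "\<And>i. Ck k (f' i)"
  shows "Ck (Suc k) f"
proof -
  have "partial i f = f' i" for i
    using partial_eqI[OF deriv] by auto
  then show ?thesis
    using assms by (auto simp: real_differentiable_def)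
qed

lemma Ck_Suc_imp_Ck: "Ck (Suc k) f \<Longrightarrow> Ck k f"
  by (induction k arbitrary: f) auto

declare Ck.simps(2) [simp del]

lemma Ck_mono: "Ck m f \<Longrightarrow> k \<le> m \<Longrightarrow> Ck k f"
  by (induction m) (auto simp: le_Suc_eq dest: Ck_Suc_imp_Ck)

lemma Ck_const: "Ck k (\<lambda>x. c)"
proof (induction k arbitrary: c)
  case (Suc k)
  show ?case
    by (rule Ck_SucI[where f' = "\<lambda>i x. 0"]) (auto intro: Suc)
qed auto

lemma Ck_component: "Ck k (\<lambda>x. x $ j)"
proof (cases k)
  case (Suc l)
  have "Ck (Suc l) (\<lambda>x. x $ j)"
  proof (rule Ck_SucI)
    show "((\<lambda>t. (x + t *\<^sub>R axis i 1) $ j) has_real_derivative axis i 1 $ j) (at 0)" for i x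
      by (auto intro!: derivative_eq_intros)
  qed (auto intro!: continuous_intros Ck_const)
  with Suc show ?thesis by simp
qed (auto intro!: continuous_intros)

lemma Ck_add:
  assumes "Ck k f" "Ck k g"
  shows "Ck k (\<lambda>x. f x + g x)"
  using assms
proof (induction k arbitrary: f g)
  case 0
  then show ?case by (auto intro: continuous_intros)
next
  case (Suc k)
  show ?case
  proof (rule Ck_SucI)
    show "continuous_on UNIV (\<lambda>x. f x + g x)"
      using Suc.prems by (intro continuous_intros) (auto dest: Ck_imp_continuous)
    show "((\<lambda>t. f (x + t *\<^sub>R axis i 1) + g (x + t *\<^sub>R axis i 1)) has_real_derivative
        partial i f x + partial i g x) (at 0)" for i x
      by (intro DERIV_add Suc.prems[THEN Ck_DERIV] zero_less_Suc)
    show "Ck k (\<lambda>x. partial i f x + partial i g x)" for i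
      using Suc.prems by (intro Suc.IH Ck_partial)
  qed
qed

lemma Ck_mult:
  assumes "Ck k f" "Ck k g"
  shows "Ck k (\<lambda>x. f x * g x)"
  using assms
proof (induction k arbitrary: f g)
  case 0
  then show ?case by (auto intro: continuous_intros)
next
  case (Suc k)
  show ?case
  proof (rule Ck_SucI)
    show "continuous_on UNIV (\<lambda>x. f x * g x)"
      using Suc.prems by (intro continuous_intros) (auto dest: Ck_imp_continuous)
    show "((\<lambda>t. f (x + t *\<^sub>R axis i 1) * g (x + t *\<^sub>R axis i 1)) has_real_derivative
        partial i f x * g x + partial i g x * f x) (at 0)" for i x
      using DERIV_mult[OF Suc.prems[THEN Ck_DERIV, OF zero_less_Suc]] by simp
    show "Ck k (\<lambda>x. partial i f x * g x + partial i g x * f x)" for i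
      by (intro Ck_add Suc.IH Suc.prems[THEN Ck_partial] Suc.prems[THEN Ck_Suc_imp_Ck])
  qed
qed

lemma Ck_sum:
  assumes "\<And>i. i \<in> A \<Longrightarrow> Ck k (f i)"
  shows "Ck k (\<lambda>x. \<Sum>i\<in>A. f i x)"
  using assms
  by (induction A rule: infinite_finite_induct) (auto intro: Ck_const Ck_add)

lemma DERIV_affine_line:
  assumes "Ck k f" "0 < k"
  shows "((\<lambda>t. d * f (c *\<^sub>R (x + t *\<^sub>R axis i 1) + a)) has_real_derivative
    (d * c) * partial i f (c *\<^sub>R x + a)) (at 0)"
proof -
  have "((\<lambda>t. f ((c *\<^sub>R x + a) + (c * t) *\<^sub>R axis i 1)) has_real_derivative
      partial i f (c *\<^sub>R x + a) * c) (at 0)"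
    by (rule DERIV_chain2[where g = "\<lambda>t. c * t" and f = "\<lambda>s. f ((c *\<^sub>R x + a) + s *\<^sub>R axis i 1)"])
      (auto intro!: Ck_DERIV[OF assms] derivative_eq_intros)
  from DERIV_cmult[OF this, of d] show ?thesis by (simp add: algebra_simps)
qed

lemma Ck_affine:
  assumes "Ck k f"
  shows "Ck k (\<lambda>x. d * f (c *\<^sub>R x + a))"
  using assms
proof (induction k arbitrary: f d)
  case 0
  then show ?case
    by (auto intro!: continuous_intros continuous_on_compose2[of UNIV f])
next
  case (Suc k)
  show ?case
  proof (rule Ck_SucI)
    show "continuous_on UNIV (\<lambda>x. d * f (c *\<^sub>R x + a))"
      using Ck_imp_continuous[OF Suc.prems]
      by (auto intro!: continuous_intros continuous_on_compose2[of UNIV f])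
    show "((\<lambda>t. d * f (c *\<^sub>R (x + t *\<^sub>R axis i 1) + a)) has_real_derivative
        (d * c) * partial i f (c *\<^sub>R x + a)) (at 0)" for i x
      by (rule DERIV_affine_line[OF Suc.prems zero_less_Suc])
    show "Ck k (\<lambda>x. (d * c) * partial i f (c *\<^sub>R x + a))" for i
      using Suc.prems by (intro Suc.IH Ck_partial)
  qed
qed

section \<open>Iterated Laplacians\<close>

lemma Ck_laplacian: "Ck (Suc (Suc k)) f \<Longrightarrow> Ck k (laplacian f)"
  unfolding laplacian_def by (intro Ck_sum Ck_partial)

lemma Ck_iterated_laplacian:
  assumes "Ck (k + 2 * m) f"
  shows "Ck k ((laplacian ^^ m) f)"
  using assms
  by (induction m arbitrary: k) (simp_all add: Ck_laplacian)

lemma laplacian_affine: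
  assumes "Ck 2 f"
  shows "laplacian (\<lambda>x. d * f (c *\<^sub>R x + a)) = (\<lambda>x. (d * c\<^sup>2) * laplacian f (c *\<^sub>R x + a))"
proof -
  have "partial i (\<lambda>x. d * f (c *\<^sub>R x + a)) = (\<lambda>x. (d * c) * partial i f (c *\<^sub>R x + a))" for i
    by (intro ext partial_eqI DERIV_affine_line[OF assms]) simp
  moreover have "partial i (\<lambda>x. (d * c) * partial i f (c *\<^sub>R x + a)) =
      (\<lambda>x. (d * c * c) * partial i (partial i f) (c *\<^sub>R x + a))" for i
    by (intro ext partial_eqI DERIV_affine_line[OF Ck_2_partial[OF assms]]) simp
  ultimately show ?thesis
    by (auto simp: laplacian_def sum_distrib_left power2_eq_square mult.assoc)
qed

lemma iterated_laplacian_affine: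
  assumes "Ck (2 * m) f"
  shows "(laplacian ^^ m) (\<lambda>x. d * f (c *\<^sub>R x + a)) =
    (\<lambda>x. d * c ^ (2 * m) * (laplacian ^^ m) f (c *\<^sub>R x + a))"
  using assms
proof (induction m arbitrary: f d)
  case (Suc m)
  have "Ck 2 f" "Ck (2 * m) (laplacian f)"
    using Ck_mono[OF Suc.prems] Suc.prems by (simp_all add: Ck_laplacian)
  then have "(laplacian ^^ Suc m) (\<lambda>x. d * f (c *\<^sub>R x + a)) =
      (\<lambda>x. d * c\<^sup>2 * c ^ (2 * m) * (laplacian ^^ m) (laplacian f) (c *\<^sub>R x + a))"
    by (simp add: funpow_Suc_right laplacian_affine Suc.IH del: funpow.simps)
  then show ?case
    by (simp add: funpow_swap1 power2_eq_square mult.assoc)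
qed simp

lemma partial_eq_0_outside:
  fixes f :: "real^'n::finite \<Rightarrow> real"
  assumes "closed S" "\<And>x. x \<notin> S \<Longrightarrow> f x = 0" "x \<notin> S"
  shows "partial i f x = 0"
proof (rule partial_eqI)
  have "((\<lambda>t. x + t *\<^sub>R axis i 1) \<longlongrightarrow> x + 0 *\<^sub>R axis i 1) (nhds 0)"
    by (intro tendsto_intros filterlim_ident)
  then have "eventually (\<lambda>t. x + t *\<^sub>R axis i 1 \<in> - S) (nhds 0)"
    using assms(1,3) by (intro topological_tendstoD) auto
  then have "eventually (\<lambda>t. f (x + t *\<^sub>R axis i 1) = 0) (nhds 0)"
    by eventually_elim (use assms(2) in auto)
  then show "((\<lambda>t. f (x + t *\<^sub>R axis i 1)) has_real_derivative 0) (at 0)"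
    by (subst DERIV_cong_ev[OF refl _ refl]) auto
qed

lemma laplacian_eq_0_outside:
  fixes f :: "real^'n::finite \<Rightarrow> real"
  assumes "closed S" "\<And>x. x \<notin> S \<Longrightarrow> f x = 0" "x \<notin> S"
  shows "laplacian f x = 0"
  unfolding laplacian_def
  by (intro sum.neutral ballI partial_eq_0_outside[OF assms(1) _ assms(3)]
      partial_eq_0_outside[OF assms(1)] assms(2))

lemma iterated_laplacian_eq_0_outside:
  fixes f :: "real^'n::finite \<Rightarrow> real"
  assumes "closed S" "\<And>x. x \<notin> S \<Longrightarrow> f x = 0" "x \<notin> S"
  shows "(laplacian ^^ m) f x = 0"
  using assms(3)
  by (induction m arbitrary: x) (auto intro: assms(2) laplacian_eq_0_outside[OF assms(1)])

section \<open>Integration by parts against compactly supported functions\<close>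

lemma has_integral_UNIV_of_support:
  fixes f :: "'a::euclidean_space \<Rightarrow> real"
  assumes "continuous_on UNIV f" "\<And>x. x \<notin> S \<Longrightarrow> f x = 0" "S \<subseteq> cbox a b"
  shows "(f has_integral integral (cbox a b) f) UNIV"
proof (rule has_integral_on_superset)
  show "(f has_integral integral (cbox a b) f) (cbox a b)"
    using assms(1)
    by (intro integrable_integral integrable_continuous) (auto intro: continuous_on_subset)
qed (use assms in auto)

lemma integrable_on_UNIV_compact_support:
  fixes f :: "'a::euclidean_space \<Rightarrow> real"
  assumes "compact S" "continuous_on UNIV f" "\<And>x. x \<notin> S \<Longrightarrow> f x = 0"
  shows "f integrable_on UNIV"
proof -
  obtain a where "S \<subseteq> cbox (- a) a"
    using bounded_subset_cbox_symmetric[OF compact_imp_bounded[OF assms(1)]] by blast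
  from has_integral_UNIV_of_support[OF assms(2,3) this] show ?thesis
    by (rule has_integral_integrable)
qed

lemma integral_UNIV_translation:
  fixes f :: "'a::euclidean_space \<Rightarrow> real"
  assumes "compact S" "continuous_on UNIV f" "\<And>x. x \<notin> S \<Longrightarrow> f x = 0"
  shows "integral UNIV (\<lambda>x. f (x + c)) = integral UNIV f"
proof -
  obtain a where S: "S \<subseteq> cbox (- a) a"
    using bounded_subset_cbox_symmetric[OF compact_imp_bounded[OF assms(1)]] by blast
  have "((\<lambda>x. f (x + c)) has_integral integral (cbox (- a - c) (a - c)) (\<lambda>x. f (x + c))) UNIV"
  proof (rule has_integral_UNIV_of_support)
    show "continuous_on UNIV (\<lambda>x. f (x + c))"
      by (rule continuous_on_compose2[OF assms(2)]) (auto intro!: continuous_intros)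
    show "f (x + c) = 0" if "x \<notin> (\<lambda>x. x - c) ` S" for x
      using that by (intro assms(3)) (auto simp: image_iff algebra_simps)
    show "(\<lambda>x. x - c) ` S \<subseteq> cbox (- a - c) (a - c)"
      using S by (force simp: mem_box inner_diff_left)
  qed
  then have "integral UNIV (\<lambda>x. f (x + c)) = integral (cbox (- a - c) (a - c)) (\<lambda>x. f (x + c))"
    by (rule integral_unique)
  also have "\<dots> = integral (cbox (- a) a) f"
    using integral_shift_cbox_plus[of "- a - c" "a - c" f c] by (simp add: o_def add.commute)
  also have "\<dots> = integral UNIV f"
    using has_integral_UNIV_of_support[OF assms(2,3) S] by (simp add: integral_unique)
  finally show ?thesis .
qed

lemma integral_UNIV_pos:
  fixes f :: "'a::euclidean_space \<Rightarrow> real"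
  assumes "compact S" "continuous_on UNIV f" "\<And>x. x \<notin> S \<Longrightarrow> f x = 0"
    and nonneg: "\<And>x. 0 \<le> f x" and "0 < f y"
  shows "0 < integral UNIV f"
proof -
  obtain a where a: "insert y S \<subseteq> box (- a) a"
    using bounded_subset_box_symmetric[of "insert y S"] compact_imp_bounded[OF assms(1)] by auto
  then have y: "y \<in> box (- a) a" and "S \<subseteq> cbox (- a) a"
    using box_subset_cbox[of "- a" a] by auto
  then have has_integral: "(f has_integral integral (cbox (- a) a) f) UNIV"
    using assms(2,3) by (intro has_integral_UNIV_of_support)
  have cont: "continuous_on (cbox (- a) a) f"
    using assms(2) by (rule continuous_on_subset) simp
  have "integral (cbox (- a) a) f \<noteq> 0"
  proof
    assume "integral (cbox (- a) a) f = 0"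
    then have "(f has_integral 0) (cbox (- a) a)"
      using integrable_integral[OF integrable_continuous[OF cont]] by simp
    from has_integral_0_cbox_imp_0[OF cont _ this, of y] show False
      using y nonneg \<open>0 < f y\<close> box_subset_cbox[of "- a" a] by auto
  qed
  moreover have "0 \<le> integral (cbox (- a) a) f"
    using cont nonneg by (intro integral_nonneg integrable_continuous) auto
  ultimately show ?thesis
    using has_integral by (simp add: integral_unique less_le)
qed

lemma DERIV_integral_UNIV_translation:
  fixes F F' :: "'a::euclidean_space \<Rightarrow> real"
  assumes "compact S"
    and F: "continuous_on UNIV F" "\<And>x. x \<notin> S \<Longrightarrow> F x = 0"
    and F': "continuous_on UNIV F'" "\<And>x. x \<notin> S \<Longrightarrow> F' x = 0"
    and deriv: "\<And>x. ((\<lambda>t. F (x + t *\<^sub>R e)) has_real_derivative F' x) (at 0)"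
  shows "((\<lambda>t. integral UNIV (\<lambda>x. F (x + t *\<^sub>R e))) has_real_derivative integral UNIV F') (at 0)"
proof -
  define T where "T = (\<lambda>(x, t). x - t *\<^sub>R e) ` (S \<times> {-1..1})"
  have "compact T"
    unfolding T_def case_prod_unfold using \<open>compact S\<close>
    by (intro compact_continuous_image compact_Times) (auto intro!: continuous_intros)
  then obtain a where T: "T \<subseteq> cbox (- a) a"
    using bounded_subset_cbox_symmetric[OF compact_imp_bounded] by blast
  have translate_outside: "x + t *\<^sub>R e \<notin> S" if "x \<notin> T" "t \<in> {-1<..<1}" for x t
    using that by (force simp: T_def image_iff)
  have cont: "continuous_on A (\<lambda>x. F (x + t *\<^sub>R e))" for A t
    by (rule continuous_on_compose2[OF F(1)]) (auto intro!: continuous_intros)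
  have integral_cbox: "integral (cbox (- a) a) (\<lambda>x. F (x + t *\<^sub>R e)) =
      integral UNIV (\<lambda>x. F (x + t *\<^sub>R e))"
    if "t \<in> {-1<..<1}" for t
    by (rule integral_unique[OF has_integral_UNIV_of_support[OF cont _ T], symmetric])
      (use translate_outside that F(2) in auto)
  have "((\<lambda>t. integral (cbox (- a) a) (\<lambda>x. F (x + t *\<^sub>R e))) has_real_derivative
      integral (cbox (- a) a) (\<lambda>x. F' (x + 0 *\<^sub>R e))) (at 0 within {-1<..<1})"
  proof (rule leibniz_rule_field_derivative)
    show "((\<lambda>t. F (x + t *\<^sub>R e)) has_real_derivative F' (x + t *\<^sub>R e))
        (at t within {-1<..<1})" for x t
      using DERIV_line[OF deriv] by (rule has_field_derivative_at_within)
    show "continuous_on ({-1<..<1} \<times> cbox (- a) a) (\<lambda>(t, x). F' (x + t *\<^sub>R e))"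
      unfolding case_prod_unfold
      by (rule continuous_on_compose2[OF F'(1)]) (auto intro!: continuous_intros)
  qed (auto intro: integrable_continuous cont)
  moreover have "S \<subseteq> T"
    by (force simp: T_def image_iff intro: bexI[where x = 0])
  then have "integral (cbox (- a) a) F' = integral UNIV F'"
    using T by (intro integral_unique[OF has_integral_UNIV_of_support[OF F'], symmetric]) auto
  ultimately have "((\<lambda>t. integral (cbox (- a) a) (\<lambda>x. F (x + t *\<^sub>R e))) has_real_derivative
      integral UNIV F') (at 0)"
    using at_within_open[of "0 :: real" "{-1<..<1}"] by simp
  then show ?thesis
    by (rule has_field_derivative_transform_within_open[where S = "{-1<..<1}"])
      (auto intro: integral_cbox)
qed

lemma integral_UNIV_directional_derivative:
  fixes F F' :: "'a::euclidean_space \<Rightarrow> real"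
  assumes "compact S"
    and F: "continuous_on UNIV F" "\<And>x. x \<notin> S \<Longrightarrow> F x = 0"
    and F': "continuous_on UNIV F'" "\<And>x. x \<notin> S \<Longrightarrow> F' x = 0"
    and deriv: "\<And>x. ((\<lambda>t. F (x + t *\<^sub>R e)) has_real_derivative F' x) (at 0)"
  shows "integral UNIV F' = 0"
proof -
  have "((\<lambda>t. integral UNIV (\<lambda>x. F (x + t *\<^sub>R e))) has_real_derivative integral UNIV F') (at 0)"
    by (rule DERIV_integral_UNIV_translation[OF assms])
  moreover have "integral UNIV (\<lambda>x. F (x + t *\<^sub>R e)) = integral UNIV F" for t
    by (rule integral_UNIV_translation[OF \<open>compact S\<close> F])
  ultimately show ?thesis
    using DERIV_unique[OF DERIV_const] by simp
qed

lemma integral_partial_by_parts: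
  fixes f \<phi> :: "real^'n::finite \<Rightarrow> real"
  assumes f: "Ck 1 f" and \<phi>: "Ck 1 \<phi>"
    and S: "compact S" "\<And>x. x \<notin> S \<Longrightarrow> \<phi> x = 0"
  shows "integral UNIV (\<lambda>x. partial i f x * \<phi> x) = - integral UNIV (\<lambda>x. f x * partial i \<phi> x)"
proof -
  have cont: "continuous_on UNIV f" "continuous_on UNIV \<phi>"
      "continuous_on UNIV (partial i f)" "continuous_on UNIV (partial i \<phi>)"
    using f \<phi> by (auto intro: Ck_imp_continuous Ck_1_imp_continuous_partial)
  have partial_\<phi>: "partial i \<phi> x = 0" if "x \<notin> S" for x
    using partial_eq_0_outside[OF compact_imp_closed[OF S(1)] S(2) that] .
  have "integral UNIV (\<lambda>x. partial i f x * \<phi> x + f x * partial i \<phi> x) = 0"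
  proof (rule integral_UNIV_directional_derivative[OF S(1)])
    show "((\<lambda>t. f (x + t *\<^sub>R axis i 1) * \<phi> (x + t *\<^sub>R axis i 1)) has_real_derivative
        partial i f x * \<phi> x + f x * partial i \<phi> x) (at 0)" for x
      using DERIV_mult[OF f[THEN Ck_DERIV, of x i] \<phi>[THEN Ck_DERIV, of x i]]
      by (simp add: mult.commute)
  qed (auto intro!: continuous_intros cont simp: S(2) partial_\<phi>)
  moreover have "(\<lambda>x. partial i f x * \<phi> x) integrable_on UNIV"
    "(\<lambda>x. f x * partial i \<phi> x) integrable_on UNIV"
    by (auto intro!: integrable_on_UNIV_compact_support[OF S(1)] continuous_intros cont
        simp: S(2) partial_\<phi>)
  ultimately show ?thesis
    by (simp add: integral_add)
qed

lemma integral_laplacian_by_parts: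
  fixes f \<phi> :: "real^'n::finite \<Rightarrow> real"
  assumes f: "Ck 2 f" and \<phi>: "Ck 2 \<phi>"
    and S: "compact S" "\<And>x. x \<notin> S \<Longrightarrow> \<phi> x = 0"
  shows "integral UNIV (\<lambda>x. laplacian f x * \<phi> x) = integral UNIV (\<lambda>x. f x * laplacian \<phi> x)"
proof -
  have f1: "Ck 1 f" "\<And>i. Ck 1 (partial i f)" and \<phi>1: "Ck 1 \<phi>" "\<And>i. Ck 1 (partial i \<phi>)"
    using Ck_mono[OF f] Ck_mono[OF \<phi>] Ck_2_partial[OF f] Ck_2_partial[OF \<phi>] by simp_all
  have cont: "continuous_on UNIV f" "continuous_on UNIV \<phi>"
      "\<And>i. continuous_on UNIV (partial i (partial i f))"
      "\<And>i. continuous_on UNIV (partial i (partial i \<phi>))"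
    using f1 \<phi>1 by (auto intro: Ck_imp_continuous Ck_1_imp_continuous_partial)
  have partial_\<phi>: "partial i \<phi> x = 0" if "x \<notin> S" for i x
    using partial_eq_0_outside[OF compact_imp_closed[OF S(1)] S(2) that] .
  have partial2_\<phi>: "partial i (partial i \<phi>) x = 0" if "x \<notin> S" for i x
    using partial_eq_0_outside[OF compact_imp_closed[OF S(1)] partial_\<phi> that] .
  note integrable = integrable_on_UNIV_compact_support[OF S(1)]
  have "integral UNIV (\<lambda>x. laplacian f x * \<phi> x) =
      (\<Sum>i\<in>UNIV. integral UNIV (\<lambda>x. partial i (partial i f) x * \<phi> x))"
    unfolding laplacian_def sum_distrib_right
    by (intro integral_sum integrable) (auto intro!: continuous_intros cont simp: S(2))
  also have "\<dots> = (\<Sum>i\<in>UNIV. integral UNIV (\<lambda>x. f x * partial i (partial i \<phi>) x))"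
    using integral_partial_by_parts[OF f1(2) \<phi>1(1) S]
      integral_partial_by_parts[OF f1(1) \<phi>1(2) S(1) partial_\<phi>] by simp
  also have "\<dots> = integral UNIV (\<lambda>x. f x * laplacian \<phi> x)"
    unfolding laplacian_def sum_distrib_left
    by (intro integral_sum[symmetric] integrable)
      (auto intro!: continuous_intros cont simp: partial2_\<phi>)
  finally show ?thesis .
qed

lemma integral_iterated_laplacian_by_parts:
  fixes f \<phi> :: "real^'n::finite \<Rightarrow> real"
  assumes "Ck (2 * m) f" "Ck (2 * m) \<phi>" and S: "compact S" "\<And>x. x \<notin> S \<Longrightarrow> \<phi> x = 0"
  shows "integral UNIV (\<lambda>x. (laplacian ^^ m) f x * \<phi> x) =
    integral UNIV (\<lambda>x. f x * (laplacian ^^ m) \<phi> x)"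
  using assms(1,2,4)
proof (induction m arbitrary: \<phi>)
  case (Suc m)
  have "Ck 2 ((laplacian ^^ m) f)" "Ck (2 * m) f" "Ck 2 \<phi>" "Ck (2 * m) (laplacian \<phi>)"
    using Suc.prems Ck_mono[OF Suc.prems(1)] Ck_mono[OF Suc.prems(2)]
    by (simp_all add: Ck_iterated_laplacian Ck_laplacian)
  moreover have "laplacian \<phi> x = 0" if "x \<notin> S" for x
    using laplacian_eq_0_outside[OF compact_imp_closed[OF S(1)] Suc.prems(3) that] .
  ultimately show ?case
    using integral_laplacian_by_parts[of "(laplacian ^^ m) f" \<phi> S] S(1) Suc.prems(3)
      Suc.IH[of "laplacian \<phi>"]
    by (simp add: funpow_swap1)
qed simp

section \<open>A bump function\<close>

lemma DERIV_max_0_power: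
  fixes t :: real
  shows "((\<lambda>t. max 0 t ^ Suc (Suc k)) has_real_derivative
    real (Suc (Suc k)) * max 0 t ^ Suc k) (at t)"
proof -
  have "((\<lambda>t. if t \<in> {0..} then t ^ Suc (Suc k) else 0) has_vector_derivative
      (if t \<in> {0..} then real (Suc (Suc k)) * t ^ Suc k else 0)) (at t within UNIV)"
  proof (rule has_vector_derivative_If_within_closures[where T = "{..0}"])
    show "((\<lambda>t. t ^ Suc (Suc k)) has_vector_derivative real (Suc (Suc k)) * t ^ Suc k)
        (at t within A)" for A
      using DERIV_pow[of "Suc (Suc k)" t A]
      by (simp only: has_real_derivative_iff_has_vector_derivative diff_Suc_Suc diff_zero)
  qed auto
  moreover have "max 0 s ^ Suc j = (if s \<in> {0..} then s ^ Suc j else 0)" for s :: real and j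
    by (simp add: max_def)
  ultimately show ?thesis
    by (simp add: has_real_derivative_iff_has_vector_derivative
        del: power_Suc of_nat_Suc split: if_splits)
qed

lemma Ck_max_0_power:
  assumes "Ck k g"
  shows "Ck k (\<lambda>x. max 0 (g x) ^ Suc k)"
  using assms
proof (induction k)
  case 0
  then show ?case by (auto intro!: continuous_intros)
next
  case (Suc k)
  show ?case
  proof (rule Ck_SucI)
    show "continuous_on UNIV (\<lambda>x. max 0 (g x) ^ Suc (Suc k))"
      by (intro continuous_intros Ck_imp_continuous[OF Suc.prems])
    show "((\<lambda>t. max 0 (g (x + t *\<^sub>R axis i 1)) ^ Suc (Suc k)) has_real_derivative
        real (Suc (Suc k)) * max 0 (g x) ^ Suc k * partial i g x) (at 0)" for i x
      using DERIV_chain2[OF DERIV_max_0_power[of k] Ck_DERIV[OF Suc.prems zero_less_Suc, of x i]]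
      by simp
    show "Ck k (\<lambda>x. real (Suc (Suc k)) * max 0 (g x) ^ Suc k * partial i g x)" for i
      by (intro Ck_mult Ck_const Suc.IH Suc.prems[THEN Ck_partial] Suc.prems[THEN Ck_Suc_imp_Ck])
  qed
qed

lemma bump_function_exists:
  obtains \<phi> :: "real^'n::finite \<Rightarrow> real"
  where "Ck k \<phi>" "\<And>x. 0 \<le> \<phi> x" "\<And>x. x \<notin> cball 0 1 \<Longrightarrow> \<phi> x = 0" "0 < integral UNIV \<phi>"
proof -
  define \<phi> :: "real^'n \<Rightarrow> real"
    where "\<phi> x = max 0 (1 + (-1) * (\<Sum>i\<in>UNIV. x $ i * x $ i)) ^ Suc k" for x
  have \<phi>_eq: "\<phi> x = max 0 (1 - (norm x)\<^sup>2) ^ Suc k" for x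
    by (simp add: \<phi>_def power2_norm_eq_inner inner_vec_def)
  have Ck: "Ck k \<phi>"
    unfolding \<phi>_def by (intro Ck_max_0_power Ck_add Ck_mult Ck_sum Ck_const Ck_component)
  moreover have nonneg: "0 \<le> \<phi> x" for x
    by (simp add: \<phi>_eq)
  moreover have outside: "\<phi> x = 0" if "x \<notin> cball 0 1" for x
  proof -
    have "1 < (norm x)\<^sup>2" using that by (simp add: one_less_power)
    then show ?thesis by (simp add: \<phi>_eq)
  qed
  moreover have "0 < integral UNIV \<phi>"
    by (rule integral_UNIV_pos[OF compact_cball[of 0 1] Ck_imp_continuous[OF Ck] outside nonneg,
          where y = 0]) (auto simp: \<phi>_eq)
  ultimately show ?thesis by (rule that)
qed

section \<open>Growth of supersolutions\<close>

lemma integral_test_function_le: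
  fixes v \<phi> :: "real^'n::finite \<Rightarrow> real"
  assumes \<phi>: "Ck (2 * m) \<phi>" "\<And>x. 0 \<le> \<phi> x" "\<And>x. x \<notin> S \<Longrightarrow> \<phi> x = 0" and S: "compact S"
    and v: "Ck (2 * m) v" and upper: "\<And>x. x \<in> S \<Longrightarrow> \<bar>v x\<bar> \<le> M"
    and lower: "\<And>x. x \<in> S \<Longrightarrow> c \<le> (laplacian ^^ m) v x"
  shows "c * integral UNIV \<phi> \<le> M * integral UNIV (\<lambda>x. \<bar>(laplacian ^^ m) \<phi> x\<bar>)"
proof -
  have lap_\<phi>: "(laplacian ^^ m) \<phi> x = 0" if "x \<notin> S" for x
    using iterated_laplacian_eq_0_outside[OF compact_imp_closed[OF S] \<phi>(3) that] .
  have cont: "continuous_on UNIV v" "continuous_on UNIV \<phi>"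
      "continuous_on UNIV ((laplacian ^^ m) v)" "continuous_on UNIV ((laplacian ^^ m) \<phi>)"
    using v \<phi>(1) Ck_iterated_laplacian[of 0 m] by (auto intro: Ck_imp_continuous)
  note integrable = integrable_on_UNIV_compact_support[OF S]
  have "c * integral UNIV \<phi> = integral UNIV (\<lambda>x. c * \<phi> x)"
    by simp
  also have "\<dots> \<le> integral UNIV (\<lambda>x. (laplacian ^^ m) v x * \<phi> x)"
  proof (rule integral_le)
    show "c * \<phi> x \<le> (laplacian ^^ m) v x * \<phi> x" for x
      using lower[of x] \<phi>(2)[of x] \<phi>(3)[of x] by (cases "x \<in> S") (auto intro: mult_right_mono)
  qed (auto intro!: integrable continuous_intros cont simp: \<phi>(3))
  also have "\<dots> = integral UNIV (\<lambda>x. v x * (laplacian ^^ m) \<phi> x)"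
    by (rule integral_iterated_laplacian_by_parts[OF v \<phi>(1) S \<phi>(3)])
  also have "\<dots> \<le> integral UNIV (\<lambda>x. M * \<bar>(laplacian ^^ m) \<phi> x\<bar>)"
  proof (rule integral_le)
    show "v x * (laplacian ^^ m) \<phi> x \<le> M * \<bar>(laplacian ^^ m) \<phi> x\<bar>" for x
    proof (cases "x \<in> S")
      case True
      have "v x * (laplacian ^^ m) \<phi> x \<le> \<bar>v x\<bar> * \<bar>(laplacian ^^ m) \<phi> x\<bar>"
        by (simp flip: abs_mult)
      also have "\<dots> \<le> M * \<bar>(laplacian ^^ m) \<phi> x\<bar>"
        using upper[OF True] by (rule mult_right_mono) simp
      finally show ?thesis .
    qed (simp add: lap_\<phi>)
  qed (auto intro!: integrable continuous_intros cont simp: lap_\<phi>)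
  also have "\<dots> = M * integral UNIV (\<lambda>x. \<bar>(laplacian ^^ m) \<phi> x\<bar>)"
    by simp
  finally show ?thesis .
qed

lemma integral_test_function_cball_le:
  fixes u \<phi> :: "real^'n::finite \<Rightarrow> real"
  assumes \<phi>: "Ck (2 * m) \<phi>" "\<And>x. 0 \<le> \<phi> x" "\<And>x. x \<notin> cball 0 1 \<Longrightarrow> \<phi> x = 0"
    and u: "Ck (2 * m) u" and "0 < R" and upper: "\<And>x. x \<in> cball a R \<Longrightarrow> \<bar>u x\<bar> \<le> M"
    and lower: "\<And>x. x \<in> cball a R \<Longrightarrow> c \<le> (laplacian ^^ m) u x"
  shows "c * R ^ (2 * m) * integral UNIV \<phi> \<le> M * integral UNIV (\<lambda>x. \<bar>(laplacian ^^ m) \<phi> x\<bar>)"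
proof (rule integral_test_function_le[OF \<phi> compact_cball])
  have in_cball: "R *\<^sub>R x + a \<in> cball a R" if "x \<in> cball 0 1" for x
    using that \<open>0 < R\<close> by (simp add: dist_norm)
  show "Ck (2 * m) (\<lambda>x. u (R *\<^sub>R x + a))"
    using Ck_affine[OF u, of 1] by simp
  show "\<bar>u (R *\<^sub>R x + a)\<bar> \<le> M" if "x \<in> cball 0 1" for x
    using upper[OF in_cball[OF that]] .
  show "c * R ^ (2 * m) \<le> (laplacian ^^ m) (\<lambda>x. u (R *\<^sub>R x + a)) x" if "x \<in> cball 0 1" for x
    using lower[OF in_cball[OF that]] \<open>0 < R\<close> iterated_laplacian_affine[OF u, of 1 R a]
    by (simp add: mult.commute)
qed

lemma iterated_laplacian_lower_bound_le:
  obtains C :: real where "0 < C"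
    "\<And>(u :: real^'n::finite \<Rightarrow> real) a R c M. Ck (2 * m) u \<Longrightarrow> 0 < R \<Longrightarrow>
      (\<And>x. x \<in> cball a R \<Longrightarrow> \<bar>u x\<bar> \<le> M) \<Longrightarrow>
      (\<And>x. x \<in> cball a R \<Longrightarrow> c \<le> (laplacian ^^ m) u x) \<Longrightarrow> c * R ^ (2 * m) \<le> C * M"
proof -
  obtain \<phi> :: "real^'n \<Rightarrow> real" where \<phi>: "Ck (2 * m) \<phi>" "\<And>x. 0 \<le> \<phi> x"
    "\<And>x. x \<notin> cball 0 1 \<Longrightarrow> \<phi> x = 0" and "0 < integral UNIV \<phi>"
    using bump_function_exists by blast
  define I where "I = integral UNIV \<phi>"
  define K where "K = integral UNIV (\<lambda>x. \<bar>(laplacian ^^ m) \<phi> x\<bar>)"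
  have "0 < I"
    using \<open>0 < integral UNIV \<phi>\<close> by (simp add: I_def)
  have "0 \<le> K"
    unfolding K_def by (cases "(\<lambda>x. \<bar>(laplacian ^^ m) \<phi> x\<bar>) integrable_on UNIV")
      (auto intro: integral_nonneg simp: not_integrable_integral)
  have "c * R ^ (2 * m) \<le> (K + 1) / I * M"
    if u: "Ck (2 * m) u" and R: "0 < R" and upper: "\<And>x. x \<in> cball a R \<Longrightarrow> \<bar>u x\<bar> \<le> M"
      and lower: "\<And>x. x \<in> cball a R \<Longrightarrow> c \<le> (laplacian ^^ m) u x"
    for u :: "real^'n \<Rightarrow> real" and a R c M
  proof -
    have "c * R ^ (2 * m) * I \<le> M * K"
      unfolding I_def K_def by (rule integral_test_function_cball_le[OF \<phi> u R upper lower])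
    also have "\<dots> \<le> M * (K + 1)"
      using order.trans[OF abs_ge_zero upper, of a] R by (simp add: distrib_left)
    finally show ?thesis
      using \<open>0 < I\<close> by (simp add: field_simps)
  qed
  moreover have "0 < (K + 1) / I"
    using \<open>0 \<le> K\<close> \<open>0 < I\<close> by simp
  ultimately show ?thesis
    using that by blast
qed

definition positive_supersolution :: "nat \<Rightarrow> real \<Rightarrow> (real^'n::finite \<Rightarrow> real) \<Rightarrow> bool" where
  "positive_supersolution m q u \<longleftrightarrow>
    Ck (2 * m) u \<and> (\<forall>x. 0 < u x) \<and> (\<forall>x. u x powr (- q) \<le> (laplacian ^^ m) u x)"

lemma positive_supersolution_radius_le:
  fixes q :: real
  assumes "0 < q"
  obtains C :: real where "0 < C"
    "\<And>(u :: real^'n::finite \<Rightarrow> real) a R M. positive_supersolution m q u \<Longrightarrow> 0 < R \<Longrightarrow>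
      (\<And>x. x \<in> cball a R \<Longrightarrow> u x \<le> M) \<Longrightarrow> R ^ (2 * m) \<le> C * M powr (q + 1)"
proof -
  obtain C :: real where "0 < C" and C:
    "\<And>(u :: real^'n \<Rightarrow> real) a R c M. Ck (2 * m) u \<Longrightarrow> 0 < R \<Longrightarrow>
      (\<And>x. x \<in> cball a R \<Longrightarrow> \<bar>u x\<bar> \<le> M) \<Longrightarrow>
      (\<And>x. x \<in> cball a R \<Longrightarrow> c \<le> (laplacian ^^ m) u x) \<Longrightarrow> c * R ^ (2 * m) \<le> C * M"
    using iterated_laplacian_lower_bound_le by blast
  have "R ^ (2 * m) \<le> C * M powr (q + 1)"
    if u: "positive_supersolution m q u" and R: "0 < R" and le_M: "\<And>x. x \<in> cball a R \<Longrightarrow> u x \<le> M"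
    for u :: "real^'n \<Rightarrow> real" and a R M
  proof -
    have u': "Ck (2 * m) u" "\<And>x. 0 < u x" "\<And>x. u x powr (- q) \<le> (laplacian ^^ m) u x"
      using u by (auto simp: positive_supersolution_def)
    have "0 < M"
      using u'(2)[of a] le_M[of a] R by simp
    have "M powr (- q) * R ^ (2 * m) \<le> C * M"
    proof (rule C[OF u'(1) R])
      fix x assume x: "x \<in> cball a R"
      show "\<bar>u x\<bar> \<le> M"
        using le_M[OF x] u'(2)[of x] by simp
      have "M powr (- q) \<le> u x powr (- q)"
        using le_M[OF x] u'(2)[of x] \<open>0 < q\<close> by (intro powr_mono2') auto
      then show "M powr (- q) \<le> (laplacian ^^ m) u x"
        using u'(3)[of x] by linarith
    qed
    then show ?thesis
      using \<open>0 < M\<close> by (simp add: powr_minus powr_add field_simps)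
  qed
  with \<open>0 < C\<close> show ?thesis
    using that by blast
qed

lemma positive_supersolution_sup_cball_gt:
  fixes q :: real
  assumes "0 < q"
  obtains \<epsilon> :: real where "0 < \<epsilon>"
    "\<And>(u :: real^'n::finite \<Rightarrow> real) a R. positive_supersolution m q u \<Longrightarrow> 0 < R \<Longrightarrow>
      \<exists>x\<in>cball a R. \<epsilon> * R powr (2 * real m / (q + 1)) < u x"
proof -
  obtain C :: real where "0 < C" and C:
    "\<And>(u :: real^'n \<Rightarrow> real) a R M. positive_supersolution m q u \<Longrightarrow> 0 < R \<Longrightarrow>
      (\<And>x. x \<in> cball a R \<Longrightarrow> u x \<le> M) \<Longrightarrow> R ^ (2 * m) \<le> C * M powr (q + 1)"
    using positive_supersolution_radius_le[OF assms] by blast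
  define \<epsilon> where "\<epsilon> = (1 / (2 * C)) powr (1 / (q + 1))"
  have "\<exists>x\<in>cball a R. \<epsilon> * R powr (2 * real m / (q + 1)) < u x"
    if u: "positive_supersolution m q u" and R: "0 < R" for u :: "real^'n \<Rightarrow> real" and a R
  proof (rule ccontr)
    assume "\<not> ?thesis"
    then have "R ^ (2 * m) \<le> C * (\<epsilon> * R powr (2 * real m / (q + 1))) powr (q + 1)"
      by (intro C[OF u R, of a]) (auto simp: not_less)
    also have "(\<epsilon> * R powr (2 * real m / (q + 1))) powr (q + 1) = R ^ (2 * m) / (2 * C)"
      using \<open>0 < q\<close> \<open>0 < C\<close> powr_realpow[OF R, of "2 * m"]
      by (simp add: \<epsilon>_def powr_mult powr_powr)
    finally show False
      using R \<open>0 < C\<close> by simp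
  qed
  moreover have "0 < \<epsilon>"
    using \<open>0 < C\<close> by (simp add: \<epsilon>_def)
  ultimately show ?thesis
    using that by blast
qed

lemma positive_supersolution_sup_annulus_gt:
  fixes q :: real
  assumes "0 < q"
  obtains \<epsilon> :: real where "0 < \<epsilon>"
    "\<And>(u :: real^'n::finite \<Rightarrow> real) R. positive_supersolution m q u \<Longrightarrow> 0 < R \<Longrightarrow>
      \<exists>x. R / 2 \<le> norm x \<and> norm x \<le> R \<and> \<epsilon> * R powr (2 * real m / (q + 1)) < u x"
proof -
  define \<alpha> where "\<alpha> = 2 * real m / (q + 1)"
  obtain \<epsilon> :: real where "0 < \<epsilon>" and \<epsilon>:
    "\<And>(u :: real^'n \<Rightarrow> real) a R. positive_supersolution m q u \<Longrightarrow> 0 < R \<Longrightarrow>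
      \<exists>x\<in>cball a R. \<epsilon> * R powr \<alpha> < u x"
    unfolding \<alpha>_def using positive_supersolution_sup_cball_gt[OF assms, of m] by metis
  have "\<exists>x. R / 2 \<le> norm x \<and> norm x \<le> R \<and> \<epsilon> / 4 powr \<alpha> * R powr \<alpha> < u x"
    if u: "positive_supersolution m q u" and R: "0 < R" for u :: "real^'n \<Rightarrow> real" and R
  proof -
    obtain a :: "real^'n" where a: "norm a = 3 / 4 * R"
      using vector_choose_size[of "3 / 4 * R"] R by auto
    obtain x where x: "dist a x \<le> R / 4" "\<epsilon> * (R / 4) powr \<alpha> < u x"
      using \<epsilon>[OF u, of "R / 4" a] R by auto
    have "R / 2 \<le> norm x" "norm x \<le> R"
      using x(1) a norm_triangle_ineq2[of a x] norm_triangle_ineq2[of x a]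
      by (simp_all add: dist_norm norm_minus_commute)
    with x(2) R show ?thesis
      by (auto simp: powr_divide)
  qed
  with \<open>0 < \<epsilon>\<close> show ?thesis
    using that[of "\<epsilon> / 4 powr \<alpha>"] by (simp add: \<alpha>_def)
qed

theorem positive_supersolution_not_smallo:
  fixes u :: "real^'n::finite \<Rightarrow> real"
  assumes "0 < q" and u: "positive_supersolution m q u"
  shows "u \<notin> o[at_infinity](\<lambda>x. norm x powr (2 * real m / (q + 1)))"
proof
  define \<alpha> where "\<alpha> = 2 * real m / (q + 1)"
  assume "u \<in> o[at_infinity](\<lambda>x. norm x powr (2 * real m / (q + 1)))"
  then have small: "u \<in> o[at_infinity](\<lambda>x. norm x powr \<alpha>)"
    by (simp only: \<alpha>_def)
  obtain \<epsilon> where "0 < \<epsilon>" and \<epsilon>: "\<And>R. 0 < R \<Longrightarrow>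
      \<exists>x. R / 2 \<le> norm x \<and> norm x \<le> R \<and> \<epsilon> * R powr \<alpha> < u x"
    unfolding \<alpha>_def using positive_supersolution_sup_annulus_gt[OF \<open>0 < q\<close>, of m] u by metis
  obtain b where b: "\<And>x. b \<le> norm x \<Longrightarrow> \<bar>u x\<bar> \<le> \<epsilon> * norm x powr \<alpha>"
    using landau_o.smallD[OF small \<open>0 < \<epsilon>\<close>] by (auto simp: eventually_at_infinity)
  define R where "R = 2 * max b 1"
  obtain x where x: "R / 2 \<le> norm x" "norm x \<le> R" "\<epsilon> * R powr \<alpha> < u x"
    using \<epsilon>[of R] by (auto simp: R_def)
  have "u x \<le> \<epsilon> * norm x powr \<alpha>"
    using b[of x] x(1) by (simp add: R_def)
  also have "\<dots> \<le> \<epsilon> * R powr \<alpha>"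
    using \<open>0 < \<epsilon>\<close> \<open>0 < q\<close> x(2) by (intro mult_left_mono powr_mono2) (auto simp: \<alpha>_def)
  finally show False
    using x(3) by simp
qed

section \<open>Eventual monotonicity of radial profiles\<close>

definition eventually_one_signed :: "('a \<Rightarrow> real) \<Rightarrow> 'a filter \<Rightarrow> bool" where
  "eventually_one_signed f A \<longleftrightarrow> (\<forall>\<^sub>F x in A. 0 \<le> f x) \<or> (\<forall>\<^sub>F x in A. f x \<le> 0)"

lemma eventually_one_signed_compose:
  assumes "eventually_one_signed f A" "filterlim g A B"
  shows "eventually_one_signed (\<lambda>x. f (g x)) B"
  using assms unfolding eventually_one_signed_def by (auto dest: eventually_compose_filterlim)

definition eventually_monotone :: "(real \<Rightarrow> real) \<Rightarrow> bool" where
  "eventually_monotone f \<longleftrightarrow> (\<exists>R. mono_on {R..} f \<or> antimono_on {R..} f)"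

lemma eventually_monotone_imp_one_signed:
  assumes "eventually_monotone f"
  shows "eventually_one_signed f at_top"
proof -
  have one_signed: "eventually_one_signed g at_top" if mono: "mono_on {R..} g"
    for g :: "real \<Rightarrow> real" and R
  proof (cases "\<exists>s\<ge>R. 0 \<le> g s")
    case True
    then obtain s where "R \<le> s" "0 \<le> g s" by blast
    then have "\<forall>r\<ge>s. 0 \<le> g r"
      using mono_onD[OF mono, of s] by force
    then show ?thesis
      by (auto simp: eventually_one_signed_def eventually_at_top_linorder)
  next
    case False
    then have "\<forall>r\<ge>R. g r \<le> 0" by force
    then show ?thesis
      by (auto simp: eventually_one_signed_def eventually_at_top_linorder)
  qed
  obtain R where "mono_on {R..} f \<or> mono_on {R..} (\<lambda>r. - f r)"
    using assms by (auto simp: eventually_monotone_def monotone_on_def)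
  then show ?thesis
    using one_signed[of R f] one_signed[of R "\<lambda>r. - f r"] by (auto simp: eventually_one_signed_def)
qed

lemma eventually_monotone_if_deriv_one_signed:
  assumes deriv: "\<forall>\<^sub>F r in at_top. (f has_real_derivative f' r) (at r)"
    and "eventually_one_signed f' at_top"
  shows "eventually_monotone f"
proof -
  have mono: "\<exists>R. mono_on {R..} g"
    if g: "\<forall>\<^sub>F r in at_top. (g has_real_derivative g' r) (at r)" "\<forall>\<^sub>F r in at_top. 0 \<le> g' r"
    for g g' :: "real \<Rightarrow> real"
  proof -
    obtain R where R: "\<And>r. R \<le> r \<Longrightarrow> (g has_real_derivative g' r) (at r) \<and> 0 \<le> g' r"
      using eventually_conj[OF g] by (auto simp: eventually_at_top_linorder)
    have "g r \<le> g s" if "R \<le> r" "r \<le> s" for r s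
      by (rule DERIV_nonneg_imp_nondecreasing[OF that(2)]) (use R that in \<open>meson order.trans\<close>)
    then show ?thesis
      by (auto simp: monotone_on_def)
  qed
  from assms(2) consider "\<forall>\<^sub>F r in at_top. 0 \<le> f' r" | "\<forall>\<^sub>F r in at_top. 0 \<le> - f' r"
    by (auto simp: eventually_one_signed_def)
  then show ?thesis
  proof cases
    case 1
    then show ?thesis
      using mono[of f f'] deriv by (auto simp: eventually_monotone_def)
  next
    case 2
    have "\<forall>\<^sub>F r in at_top. ((\<lambda>r. - f r) has_real_derivative - f' r) (at r)"
      using deriv by eventually_elim (rule DERIV_minus)
    then obtain R where "mono_on {R..} (\<lambda>r. - f r)"
      using mono[of "\<lambda>r. - f r" "\<lambda>r. - f' r"] 2 by blast
    then show ?thesis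
      by (auto simp: eventually_monotone_def monotone_on_def)
  qed
qed

lemma eventually_one_signed_power_mult_iff:
  "eventually_one_signed (\<lambda>r. r ^ k * f r) at_top \<longleftrightarrow> eventually_one_signed f at_top"
proof -
  have "0 \<le> r ^ k * f r \<longleftrightarrow> 0 \<le> f r" "r ^ k * f r \<le> 0 \<longleftrightarrow> f r \<le> 0" if "0 < r" for r
    using that mult_le_cancel_left_pos[of "r ^ k" 0 "f r"]
      mult_le_cancel_left_pos[of "r ^ k" "f r" 0] by simp_all
  then have "(\<forall>\<^sub>F r in at_top. 0 \<le> r ^ k * f r) \<longleftrightarrow> (\<forall>\<^sub>F r in at_top. 0 \<le> f r)"
    "(\<forall>\<^sub>F r in at_top. r ^ k * f r \<le> 0) \<longleftrightarrow> (\<forall>\<^sub>F r in at_top. f r \<le> 0)"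
    by (auto intro!: eventually_subst intro: eventually_mono[OF eventually_gt_at_top[of 0]])
  then show ?thesis
    by (simp add: eventually_one_signed_def)
qed

lemma DERIV_norm_line:
  fixes x e :: "'a::real_inner"
  assumes "x \<noteq> 0"
  shows "((\<lambda>t. norm (x + t *\<^sub>R e)) has_real_derivative inner e x / norm x) (at 0)"
proof -
  have "((\<lambda>t. x + t *\<^sub>R e) has_derivative (\<lambda>t. t *\<^sub>R e)) (at 0)"
    by (auto intro!: derivative_eq_intros)
  moreover have "(norm has_derivative (\<lambda>h. inner h (sgn x))) (at (x + 0 *\<^sub>R e))"
    using has_derivative_norm[OF assms] by simp
  ultimately have "((\<lambda>t. norm (x + t *\<^sub>R e)) has_derivative (\<lambda>t. inner (t *\<^sub>R e) (sgn x))) (at 0)"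
    by (rule has_derivative_compose)
  then show ?thesis
    by (rule has_derivative_imp_has_field_derivative) (simp add: sgn_div_norm divide_inverse)
qed

lemma partial_radial:
  fixes f :: "real^'n::finite \<Rightarrow> real"
  assumes "\<And>x. f x = F (norm x)" "x \<noteq> 0" "(F has_real_derivative D) (at (norm x))"
  shows "partial i f x = D * (x $ i / norm x)"
proof (rule partial_eqI)
  have "((\<lambda>t. F (norm (x + t *\<^sub>R axis i 1))) has_real_derivative
      D * (inner (axis i 1) x / norm x)) (at 0)"
    using assms by (intro DERIV_chain2[OF _ DERIV_norm_line]) auto
  then show "((\<lambda>t. f (x + t *\<^sub>R axis i 1)) has_real_derivative D * (x $ i / norm x)) (at 0)"
    by (simp add: assms(1) inner_axis')
qed

lemma partial_partial_radial:
  fixes f :: "real^'n::finite \<Rightarrow> real"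
  assumes f: "\<And>x. f x = F (norm x)"
    and F: "\<And>r. 0 < r \<Longrightarrow> (F has_real_derivative F' r) (at r)"
    and F': "(F' has_real_derivative D) (at (norm x))"
    and x: "x \<noteq> 0"
  shows "partial i (partial i f) x =
    D * (x $ i / norm x)\<^sup>2 + F' (norm x) * (1 / norm x - (x $ i)\<^sup>2 / norm x ^ 3)"
proof (rule partial_eqI)
  let ?line = "\<lambda>t. x + t *\<^sub>R axis i 1"
  let ?deriv = "D * (x $ i / norm x)\<^sup>2 + F' (norm x) * (1 / norm x - (x $ i)\<^sup>2 / norm x ^ 3)"
  have norm: "((\<lambda>t. norm (?line t)) has_real_derivative x $ i / norm x) (at 0)"
    using DERIV_norm_line[OF x, of "axis i 1"] by (simp add: inner_axis')
  have F'_norm: "((\<lambda>t. F' (norm (?line t))) has_real_derivative D * (x $ i / norm x)) (at 0)"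
    using F' by (intro DERIV_chain2[OF _ norm]) simp
  have "((\<lambda>t. x $ i + t) has_real_derivative 1) (at 0)"
    by (auto intro!: derivative_eq_intros)
  from DERIV_divide[OF this norm]
  have quotient: "((\<lambda>t. (x $ i + t) / norm (?line t)) has_real_derivative
      (norm x - x $ i * (x $ i / norm x)) / (norm x * norm x)) (at 0)"
    using x by simp
  have "((\<lambda>t. F' (norm (?line t)) * ((x $ i + t) / norm (?line t))) has_real_derivative ?deriv)
      (at 0)"
    using DERIV_mult[OF F'_norm quotient]
    by (rule DERIV_cong) (use x in \<open>simp add: field_simps power2_eq_square power3_eq_cube\<close>)
  moreover have "\<forall>\<^sub>F t in nhds 0. partial i f (?line t) =
      F' (norm (?line t)) * ((x $ i + t) / norm (?line t))"
  proof -
    have "(?line \<longlongrightarrow> x + 0 *\<^sub>R axis i 1) (nhds 0)"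
      by (intro tendsto_intros filterlim_ident)
    then have "\<forall>\<^sub>F t in nhds 0. ?line t \<noteq> 0"
      using x by (intro tendsto_imp_eventually_ne) auto
    then show ?thesis
      by eventually_elim (simp add: partial_radial[OF f _ F])
  qed
  ultimately show "((\<lambda>t. partial i f (?line t)) has_real_derivative ?deriv) (at 0)"
    by (subst DERIV_cong_ev[OF refl _ refl])
qed

lemma laplacian_radial:
  fixes f :: "real^'n::finite \<Rightarrow> real"
  assumes f: "\<And>x. f x = F (norm x)"
    and F: "\<And>r. 0 < r \<Longrightarrow> (F has_real_derivative F' r) (at r)"
    and F': "\<And>r. 0 < r \<Longrightarrow> (F' has_real_derivative F'' r) (at r)"
    and x: "x \<noteq> 0"
  shows "laplacian f x = F'' (norm x) + (real CARD('n) - 1) / norm x * F' (norm x)"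
proof -
  have sum_squares: "(\<Sum>i\<in>UNIV. (x $ i)\<^sup>2) = (norm x)\<^sup>2"
    unfolding power2_norm_eq_inner inner_vec_def by (simp add: power2_eq_square)
  have "laplacian f x = F'' (norm x) / (norm x)\<^sup>2 * (\<Sum>i\<in>UNIV. (x $ i)\<^sup>2)
      + F' (norm x) * (real CARD('n) / norm x - (\<Sum>i\<in>UNIV. (x $ i)\<^sup>2) / norm x ^ 3)"
    using x unfolding laplacian_def
    by (simp add: partial_partial_radial[OF f F F'] sum.distrib sum_subtractf power_divide
        flip: sum_distrib_left sum_divide_distrib)
  also have "\<dots> = F'' (norm x) + (real CARD('n) - 1) / norm x * F' (norm x)"
    unfolding sum_squares using x by (simp add: field_simps power2_eq_square power3_eq_cube)
  finally show ?thesis .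
qed

lemma radial_profile_derivatives:
  fixes f :: "real^'n::finite \<Rightarrow> real"
  assumes "Ck 2 f" and f: "\<And>x. f x = F (norm x)"
  obtains F' F'' where "\<And>r. 0 < r \<Longrightarrow> (F has_real_derivative F' r) (at r)"
    "\<And>r. 0 < r \<Longrightarrow> (F' has_real_derivative F'' r) (at r)"
proof -
  fix i :: 'n
  define e :: "real^'n" where "e = axis i 1"
  have along_axis: "((\<lambda>s. g (s *\<^sub>R e)) has_real_derivative partial i g (r *\<^sub>R e)) (at r)"
    if "Ck k g" "0 < k" for g k r
    using DERIV_line[OF Ck_DERIV[OF that, of _ i], of 0 r] by (simp add: e_def)
  have "(F has_real_derivative partial i f (r *\<^sub>R e)) (at r)" if "0 < r" for r
  proof -
    have "\<forall>\<^sub>F s in nhds r. F s = f (s *\<^sub>R e)"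
      using eventually_nhds_in_open[of "{0<..}" r] that
      by (auto elim!: eventually_mono simp: f e_def norm_axis_1)
    then show ?thesis
      using along_axis[OF \<open>Ck 2 f\<close>] by (subst DERIV_cong_ev[OF refl _ refl]) auto
  qed
  moreover have "((\<lambda>s. partial i f (s *\<^sub>R e)) has_real_derivative
      partial i (partial i f) (r *\<^sub>R e)) (at r)" if "0 < r" for r
    using along_axis[OF Ck_2_partial[OF \<open>Ck 2 f\<close>]] by simp
  ultimately show ?thesis
    by (rule that)
qed

lemma laplacian_radial_profile:
  fixes f :: "real^'n::finite \<Rightarrow> real"
  assumes "Ck 2 f" and f: "\<And>x. f x = F (norm x)"
  obtains G where "\<And>x. laplacian f x = G (norm x)"
proof -
  obtain F' F'' where F: "\<And>r. 0 < r \<Longrightarrow> (F has_real_derivative F' r) (at r)"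
    "\<And>r. 0 < r \<Longrightarrow> (F' has_real_derivative F'' r) (at r)"
    using radial_profile_derivatives[OF assms] by blast
  have "laplacian f x = (if norm x = 0 then laplacian f 0 else
      F'' (norm x) + (real CARD('n) - 1) / norm x * F' (norm x))" for x
    using laplacian_radial[OF f F] by simp
  then show ?thesis
    by (rule that)
qed

text \<open>The Laplacian of a radial function is r ^ (1 - n) times the derivative of the flux
  r ^ (n - 1) * F' r. Hence a one-signed Laplacian makes the flux monotone, so the flux and F' are
  eventually one-signed, so F is eventually monotone.\<close>

lemma radial_eventually_monotone:
  fixes f :: "real^'n::finite \<Rightarrow> real"
  assumes "Ck 2 f" and f: "\<And>x. f x = F (norm x)"
    and one_signed: "eventually_one_signed (laplacian f) at_infinity"
  shows "eventually_monotone F"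
proof -
  define N where "N = CARD('n) - 1"
  obtain e :: "real^'n" where e: "norm e = 1"
    using vector_choose_size[of 1] by auto
  define G where "G r = laplacian f (r *\<^sub>R e)" for r
  obtain F' F'' where F: "\<And>r. 0 < r \<Longrightarrow> (F has_real_derivative F' r) (at r)"
    "\<And>r. 0 < r \<Longrightarrow> (F' has_real_derivative F'' r) (at r)"
    using radial_profile_derivatives[OF assms(1) f] by blast
  have flux: "((\<lambda>r. r ^ N * F' r) has_real_derivative r ^ N * G r) (at r)" if r: "0 < r" for r
  proof -
    have "r *\<^sub>R e \<noteq> 0" "norm (r *\<^sub>R e) = r"
      using e r by auto
    moreover have "real N = real CARD('n) - 1"
      by (simp add: N_def of_nat_diff)
    ultimately have "G r = F'' r + real N / r * F' r"
      using laplacian_radial[OF f F, of "r *\<^sub>R e"] by (simp add: G_def)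
    moreover have "real N * r ^ (N - Suc 0) = r ^ N * (real N / r)"
      using r by (cases N) auto
    ultimately have "real N * r ^ (N - Suc 0) * F' r + F'' r * r ^ N = r ^ N * G r"
      by (simp add: distrib_left mult_ac)
    with DERIV_mult[OF DERIV_pow[of N r] F(2)[OF r]] show ?thesis
      by simp
  qed
  have "filterlim (\<lambda>r. r *\<^sub>R e) at_infinity at_top"
    by (simp add: filterlim_at_infinity_conv_norm_at_top e filterlim_abs_real)
  with one_signed have "eventually_one_signed G at_top"
    unfolding G_def by (rule eventually_one_signed_compose)
  then have "eventually_one_signed (\<lambda>r. r ^ N * G r) at_top"
    by (simp add: eventually_one_signed_power_mult_iff)
  with eventually_mono[OF eventually_gt_at_top flux] have "eventually_monotone (\<lambda>r. r ^ N * F' r)"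
    by (rule eventually_monotone_if_deriv_one_signed)
  then have "eventually_one_signed F' at_top"
    using eventually_monotone_imp_one_signed eventually_one_signed_power_mult_iff by blast
  with eventually_mono[OF eventually_gt_at_top F(1)] show ?thesis
    by (rule eventually_monotone_if_deriv_one_signed)
qed

lemma radial_iterated_laplacian_one_signed_imp_one_signed:
  fixes f :: "real^'n::finite \<Rightarrow> real"
  assumes "Ck (2 * m) f" "\<And>x. f x = F (norm x)"
    and "eventually_one_signed ((laplacian ^^ m) f) at_infinity"
  shows "eventually_one_signed f at_infinity"
  using assms
proof (induction m arbitrary: f F)
  case (Suc m)
  have Ck: "Ck 2 f" "Ck (2 * m) (laplacian f)"
    using Ck_mono[OF Suc.prems(1)] Suc.prems(1) by (simp_all add: Ck_laplacian)
  obtain G where G: "\<And>x. laplacian f x = G (norm x)"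
    using laplacian_radial_profile[OF Ck(1) Suc.prems(2)] by blast
  have "eventually_one_signed (laplacian f) at_infinity"
    using Suc.IH[OF Ck(2) G] Suc.prems(3) by (simp add: funpow_swap1)
  then have "eventually_one_signed F at_top"
    by (intro eventually_monotone_imp_one_signed radial_eventually_monotone[OF Ck(1) Suc.prems(2)])
  then have "eventually_one_signed (\<lambda>x :: real^'n. F (norm x)) at_infinity"
    by (rule eventually_one_signed_compose[OF _ filterlim_norm_at_top])
  moreover have "f = (\<lambda>x. F (norm x))"
    using Suc.prems(2) by (rule ext)
  ultimately show ?case
    by (simp only:)
qed simp

lemma radial_iterated_laplacian_one_signed_imp_eventually_monotone:
  fixes f :: "real^'n::finite \<Rightarrow> real"
  assumes "Ck (2 * m) f" "0 < m" and f: "\<And>x. f x = F (norm x)"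
    and "eventually_one_signed ((laplacian ^^ m) f) at_infinity"
  shows "eventually_monotone F"
proof -
  obtain l where m: "m = Suc l"
    using \<open>0 < m\<close> gr0_conv_Suc by blast
  have Ck: "Ck 2 f" "Ck (2 * l) (laplacian f)"
    using Ck_mono[OF assms(1)] assms(1) by (simp_all add: m Ck_laplacian)
  obtain G where G: "\<And>x. laplacian f x = G (norm x)"
    using laplacian_radial_profile[OF Ck(1) f] by blast
  have "eventually_one_signed (laplacian f) at_infinity"
    using radial_iterated_laplacian_one_signed_imp_one_signed[OF Ck(2) G] assms(4)
    by (simp add: m funpow_swap1)
  then show ?thesis
    by (rule radial_eventually_monotone[OF Ck(1) f])
qed

section \<open>Radial supersolutions\<close>

lemma positive_supersolution_radial_mono_ge:
  fixes v :: "real \<Rightarrow> real" and u :: "real^'n::finite \<Rightarrow> real"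
  assumes "0 < q" and u: "positive_supersolution m q u" and v: "\<And>x. u x = v (norm x)"
    and mono: "mono_on {R..} v"
  obtains \<epsilon> where "0 < \<epsilon>" "\<forall>\<^sub>F r in at_top. \<epsilon> \<le> v r / r powr (2 * real m / (q + 1))"
proof -
  define \<alpha> where "\<alpha> = 2 * real m / (q + 1)"
  obtain \<epsilon> where "0 < \<epsilon>" and \<epsilon>: "\<And>r. 0 < r \<Longrightarrow>
      \<exists>x. r / 2 \<le> norm x \<and> norm x \<le> r \<and> \<epsilon> * r powr \<alpha> < u x"
    unfolding \<alpha>_def using positive_supersolution_sup_annulus_gt[OF \<open>0 < q\<close>, of m] u by metis
  have "\<epsilon> \<le> v r / r powr \<alpha>" if r: "max 1 (2 * R) \<le> r" for r
  proof -
    obtain x where x: "r / 2 \<le> norm x" "norm x \<le> r" "\<epsilon> * r powr \<alpha> < u x"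
      using \<epsilon>[of r] r by auto
    have "u x \<le> v r"
      using mono_onD[OF mono, of "norm x" r] x r by (simp add: v)
    with x(3) r show ?thesis
      by (simp add: pos_le_divide_eq)
  qed
  then have "\<forall>\<^sub>F r in at_top. \<epsilon> \<le> v r / r powr \<alpha>"
    unfolding eventually_at_top_linorder by blast
  with \<open>0 < \<epsilon>\<close> show ?thesis
    using that by (simp add: \<alpha>_def)
qed

lemma radial_antimono_smallo_norm_powr:
  fixes v :: "real \<Rightarrow> real" and u :: "'a::real_normed_vector \<Rightarrow> real"
  assumes v: "\<And>x. u x = v (norm x)" and antimono: "antimono_on {R..} v"
    and nonneg: "\<And>x. 0 \<le> u x" and "0 < \<alpha>"
  shows "u \<in> o[at_infinity](\<lambda>x. norm x powr \<alpha>)"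
proof -
  have "\<bar>u x\<bar> \<le> v R" if "R \<le> norm x" for x
    using monotone_onD[OF antimono, of R "norm x"] that nonneg[of x] by (simp add: v)
  then have "u \<in> O[at_infinity](\<lambda>_. 1)"
    by (intro bigoI[where c = "v R"]) (auto simp: eventually_at_infinity)
  also have "(\<lambda>_. 1) \<in> o[at_infinity](\<lambda>x :: 'a. norm x powr \<alpha>)"
  proof (rule smalloI_tendsto)
    show "((\<lambda>x :: 'a. 1 / norm x powr \<alpha>) \<longlongrightarrow> 0) at_infinity"
      using tendsto_neg_powr[OF _ filterlim_norm_at_top, of "- \<alpha>"] \<open>0 < \<alpha>\<close>
      by (simp add: powr_minus_divide)
    show "\<forall>\<^sub>F x :: 'a in at_infinity. norm x powr \<alpha> \<noteq> 0"
      by (auto simp: eventually_at_infinity intro!: exI[of _ 1])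
  qed
  finally show ?thesis .
qed

theorem radial_positive_supersolution_Liminf_nonzero:
  fixes v :: "real \<Rightarrow> real" and u :: "real^'n::finite \<Rightarrow> real"
  assumes "0 < q" "0 < m" and u: "positive_supersolution m q u" and v: "\<And>x. u x = v (norm x)"
  shows "Liminf at_top (\<lambda>r. ereal (v r / r powr (2 * real m / (q + 1)))) \<noteq> 0"
proof -
  have Ck: "Ck (2 * m) u" and pos: "0 < u x" and "u x powr (- q) \<le> (laplacian ^^ m) u x" for x
    using u by (auto simp: positive_supersolution_def)
  then have "0 \<le> (laplacian ^^ m) u x" for x
    by (meson order.trans powr_ge_zero)
  then have "eventually_monotone v"
    using radial_iterated_laplacian_one_signed_imp_eventually_monotone[of m u v] Ck \<open>0 < m\<close> v
    by (simp add: eventually_one_signed_def)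
  moreover have "\<not> antimono_on {R..} v" for R
    using radial_antimono_smallo_norm_powr[of u v R] positive_supersolution_not_smallo[OF \<open>0 < q\<close> u]
      assms(1,2) v pos by (auto simp: less_imp_le)
  ultimately obtain R where "mono_on {R..} v"
    by (auto simp: eventually_monotone_def)
  then obtain \<epsilon> where "0 < \<epsilon>" "\<forall>\<^sub>F r in at_top. \<epsilon> \<le> v r / r powr (2 * real m / (q + 1))"
    using positive_supersolution_radial_mono_ge[OF \<open>0 < q\<close> u v] by blast
  then have "ereal \<epsilon> \<le> Liminf at_top (\<lambda>r. ereal (v r / r powr (2 * real m / (q + 1))))"
    by (intro Liminf_bounded) simp
  with \<open>0 < \<epsilon>\<close> show ?thesis
    by auto
qed

theorem mainTheorem7:
  fixes q :: real
  assumes n2: "CARD('n::finite) \<ge> 2"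
    and q: "q > 0"
  shows "(\<not> (\<exists>u :: real^'n \<Rightarrow> real.
              Ck 6 u \<and> (\<forall>x. u x > 0) \<and>
              (\<forall>x. laplacian (laplacian (laplacian u)) x = u x powr (- q)) \<and>
              u \<in> o[at_infinity](\<lambda>x. norm x powr (6 / (q + 1)))) \<and>
         \<not> (\<exists>v :: real \<Rightarrow> real.
              let u = (\<lambda>x :: real^'n. v (norm x)) in
              Ck 6 u \<and> (\<forall>x. u x > 0) \<and>
              (\<forall>x. laplacian (laplacian (laplacian u)) x = u x powr (- q)) \<and>
              Limsup at_top (\<lambda>r. ereal (v r / r powr (6 / (q + 1)))) < \<infinity> \<and>
              Liminf at_top (\<lambda>r. ereal (v r / r powr (6 / (q + 1)))) = 0))"
proof -
  have supersolution: "positive_supersolution 3 q u"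
    if "Ck 6 u" "\<forall>x. u x > 0" "\<forall>x. laplacian (laplacian (laplacian u)) x = u x powr (- q)"
    for u :: "real^'n \<Rightarrow> real"
    using that by (simp add: positive_supersolution_def eval_nat_numeral)
  show ?thesis
    unfolding Let_def
    using positive_supersolution_not_smallo[OF q supersolution]
      radial_positive_supersolution_Liminf_nonzero[OF q _ supersolution refl] by auto
qed

end
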